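(* Let $b\in\{2,3\}$ and let $(C_{uv})_{u,v=1}^b$ be a complex $b\times b$ matrix. The following two conditions are equivalent: (1) $(C_{uv})$ is the response of a connected electrical network with $b$ boundary vertices all of whose edge conductances have positive real parts; (2) $(C_{uv})$ is symmetric, the sum of the entries in each row is zero, the real matrix $(\operatorname{Re}C_{uv})$ is non-negatively definite, and whenever real numbers $U_1,\dots,U_b$ satisfy $\sum_{1\le u,v\le b}\operatorname{Re}C_{uv}\,U_uU_v=0$ we have $U_1=\dots=U_b$.
   Context: An electrical network is a finite graph without loops or multiple edges, with vertices $1,\dots,n$, of which $1,\dots,b$ are called boundary vertices, and with a complex number $c_{kl}=c_{lk}$ (conductance) assigned to each edge $kl$; here all conductances have positive real part, and $c_{kl}=0$ if there is no edge between $k$ and $l$. Given incoming voltages $U_1,\dots,U_b\in\mathbb{C}$ at the boundary vertices, the voltages $U_{b+1},\dots,U_n$ and currents $I_{kl}$ are determined by Ohm's law $I_{kl}=c_{kl}(U_k-U_l)$ for all $k,l$ and Kirchhoff's law $\sum_{l=1}^n I_{kl}=0$ for every $k>b$ (this system has a unique solution when each connected component contains a boundary vertex). The incoming currents are $I_u=\sum_{k=1}^n I_{uk}$, $u=1,\dots,b$. The response of the network is the matrix $(C_{uv})$ of the linear map $(U_1,\dots,U_b)\mapsto(I_1,\dots,I_b)$, i.e. $I_v=\sum_u C_{uv}U_u$. *)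

theory Defs
  imports Complex_Main "Graph_Theory.Digraph_Component"
begin

text \<open>
  A \<open>pair_graph\<close> is a finite symmetric loop-free digraph whose arcs are pairs of vertices, i.e. a
  finite undirected graph without loops and multiple edges; an edge \<open>kl\<close> is represented by the two
  arcs \<open>(k, l)\<close> and \<open>(l, k)\<close>. The boundary vertices are \<open>1, \<dots>, b\<close>.
\<close>

locale electrical_network = pair_graph G
  for n b :: nat and G :: "nat pair_pre_digraph" and c :: "nat \<Rightarrow> nat \<Rightarrow> complex" +
  assumes vertices: "pverts G = {1..n}"
    and boundary: "b \<le> n"
    and conductance_sym: "c k l = c l k"
    and conductance_no_edge: "(k, l) \<notin> parcs G \<Longrightarrow> c k l = 0"

definition current :: "(nat \<Rightarrow> nat \<Rightarrow> complex) \<Rightarrow> (nat \<Rightarrow> complex) \<Rightarrow> nat \<Rightarrow> nat \<Rightarrow> complex" where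
  "current c U k l = c k l * (U k - U l)"

definition voltages ::
  "nat \<Rightarrow> nat \<Rightarrow> (nat \<Rightarrow> nat \<Rightarrow> complex) \<Rightarrow> (nat \<Rightarrow> complex) \<Rightarrow> (nat \<Rightarrow> complex) \<Rightarrow> bool" where
  "voltages n b c Uin U \<longleftrightarrow>
     (\<forall>u\<in>{1..b}. U u = Uin u) \<and>
     (\<forall>k\<in>{b<..n}. (\<Sum>l=1..n. current c U k l) = 0)"

definition incoming_current ::
  "nat \<Rightarrow> (nat \<Rightarrow> nat \<Rightarrow> complex) \<Rightarrow> (nat \<Rightarrow> complex) \<Rightarrow> nat \<Rightarrow> complex" where
  "incoming_current n c U u = (\<Sum>k=1..n. current c U u k)"

text \<open>
  The map from incoming voltages to incoming currents is total and single-valued, and \<open>C\<close> is its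
  matrix. Only the entries \<open>C u v\<close> with \<open>u, v \<in> {1..b}\<close> are relevant.
\<close>

definition is_response ::
  "nat \<Rightarrow> nat \<Rightarrow> (nat \<Rightarrow> nat \<Rightarrow> complex) \<Rightarrow> (nat \<Rightarrow> nat \<Rightarrow> complex) \<Rightarrow> bool" where
  "is_response n b c C \<longleftrightarrow>
     (\<forall>Uin. (\<exists>U. voltages n b c Uin U) \<and>
       (\<forall>U. voltages n b c Uin U \<longrightarrow>
          (\<forall>v\<in>{1..b}. incoming_current n c U v = (\<Sum>u=1..b. C u v * Uin u))))"

end

theory Submission
  imports Defs
begin

text \<open>
  Necessity. Writing \<open>\<Sum>\<^sub>v I\<^sub>v W\<^sub>v\<close> as the Dirichlet form
  \<open>\<Sum>\<^bsub>kl\<^esub> c\<^bsub>kl\<^esub> (U\<^sub>k - U\<^sub>l) (W\<^sub>k - W\<^sub>l) / 2\<close> shows that the response is symmetric; with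
  \<open>W\<close> the complex conjugate of \<open>U\<close> and real incoming voltages it shows that
  the real part is non-negative and vanishes only if \<open>U\<close> is constant along every edge.

  Sufficiency. The edges between boundary vertices can absorb any imaginary part, so only the real
  parts \<open>a\<^bsub>ij\<^esub> = - Re C\<^bsub>ij\<^esub>\<close>, some of which may be negative, matter. A star whose
  hub conductances have imaginary parts of zero sum proportional to \<open>t\<^sub>i\<close> contributes to the real part
  of the response the square of the linear form with coefficients \<open>t\<^sub>i\<close>, up to a small error. It
  remains to find \<open>t\<close> of zero sum with \<open>a\<^bsub>ij\<^esub> + t\<^sub>i t\<^sub>j > 0\<close> for all \<open>i \<noteq> j\<close>: for \<open>b = 2\<close> take \<open>t = 0\<close>,
  and for \<open>b = 3\<close> positive definiteness gives
  \<open>a\<^sub>1\<^sub>2 a\<^sub>1\<^sub>3 + a\<^sub>1\<^sub>2 a\<^sub>2\<^sub>3 + a\<^sub>1\<^sub>3 a\<^sub>2\<^sub>3 > 0\<close>, which leaves room for such a \<open>t\<close>.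
\<close>

section \<open>Responses of networks\<close>

text \<open>Summation by parts: the current is antisymmetric in \<open>k\<close> and
  \<open>l\<close>, so exchanging them shows that weighting by \<open>- W l\<close> gives the same
  double sum as weighting by \<open>W k\<close>.\<close>

lemma dirichlet_form_incoming_current:
  assumes sym: "\<And>k l. c k l = c l k"
  shows "(\<Sum>k=1..n. W k * incoming_current n c U k) =
    (\<Sum>k=1..n. \<Sum>l=1..n. c k l * (U k - U l) * (W k - W l)) / 2"
proof -
  let ?S = "\<Sum>k=1..n. \<Sum>l=1..n. c k l * (U k - U l) * W k"
  let ?T = "\<Sum>k=1..n. \<Sum>l=1..n. c k l * (U k - U l) * W l"
  have "?T = (\<Sum>k=1..n. \<Sum>l=1..n. c l k * (U l - U k) * W k)"
    by (rule sum.swap)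
  also have "\<dots> = - ?S"
    unfolding sum_negf[symmetric]
    by (intro sum.cong refl) (simp add: sym[of l k for l k] algebra_simps)
  finally have T: "?T = - ?S" .
  have "(\<Sum>k=1..n. \<Sum>l=1..n. c k l * (U k - U l) * (W k - W l)) = ?S - ?T"
    by (simp add: sum_subtractf[symmetric] right_diff_distrib)
  moreover have "(\<Sum>k=1..n. W k * incoming_current n c U k) = ?S"
    by (simp add: incoming_current_def current_def sum_distrib_left mult_ac)
  ultimately show ?thesis
    using T by simp
qed

text \<open>Kirchhoff's law removes the interior terms, so the left side sees only the boundary
  values of \<open>W\<close>, whatever \<open>W\<close> is at interior vertices.\<close>

lemma response_dirichlet_form:
  assumes sym: "\<And>k l. c k l = c l k" and "b \<le> n"
    and "is_response n b c C" and V: "voltages n b c Uin U"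
  shows "(\<Sum>v=1..b. W v * (\<Sum>u=1..b. C u v * Uin u)) =
    (\<Sum>k=1..n. \<Sum>l=1..n. c k l * (U k - U l) * (W k - W l)) / 2"
proof -
  have "(\<Sum>v=1..b. W v * (\<Sum>u=1..b. C u v * Uin u)) =
      (\<Sum>v=1..b. W v * incoming_current n c U v)"
    using assms(3) V unfolding is_response_def by (intro sum.cong) auto
  also have "\<dots> = (\<Sum>k=1..n. W k * incoming_current n c U k)"
    using V \<open>b \<le> n\<close> unfolding voltages_def incoming_current_def
    by (intro sum.mono_neutral_left) auto
  also have "\<dots> = (\<Sum>k=1..n. \<Sum>l=1..n. c k l * (U k - U l) * (W k - W l)) / 2"
    by (rule dirichlet_form_incoming_current[OF sym])
  finally show ?thesis .
qed

lemma (in electrical_network) connected_eq_if_eq_on_arcs: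
  assumes "Digraph_Component.connected (with_proj G)"
    and eq: "\<And>k l. (k, l) \<in> parcs G \<Longrightarrow> f k = f l"
    and "u \<in> {1..n}" "v \<in> {1..n}"
  shows "f u = f v"
proof -
  have "u \<rightarrow>\<^sup>*\<^bsub>with_proj (mk_symmetric (with_proj G))\<^esub> v"
    using assms vertices unfolding Digraph_Component.connected_def strongly_connected_def by simp
  then have "(u, v) \<in> (parcs (mk_symmetric (with_proj G)))\<^sup>*"
    using reachable_rtranclI by fastforce
  then show ?thesis
    by (induction rule: rtrancl_induct) (auto simp: parcs_mk_symmetric dest!: eq)
qed

section \<open>Symmetry, zero sums and positivity of the response\<close>

text \<open>Unit voltages at \<open>u\<close> and at \<open>v\<close>, extended to the interior,
  express both entries by the same Dirichlet form, which is symmetric in its two arguments.\<close>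

lemma response_symmetric:
  assumes sym: "\<And>k l. c k l = c l k" and "b \<le> n" and resp: "is_response n b c C"
    and uv: "u \<in> {1..b}" "v \<in> {1..b}"
  shows "C u v = C v u"
proof -
  define e :: "nat \<Rightarrow> nat \<Rightarrow> complex" where "e i j = (if j = i then 1 else 0)" for i j
  have "\<forall>i. \<exists>V. voltages n b c (e i) V"
    using resp unfolding is_response_def by blast
  then obtain V where V: "voltages n b c (e i) (V i)" for i
    unfolding choice_iff by blast
  define D where
    "D i j = (\<Sum>k=1..n. \<Sum>l=1..n. c k l * (V i k - V i l) * (V j k - V j l)) / 2" for i j
  have C_eq: "C i j = D i j" if ij: "i \<in> {1..b}" "j \<in> {1..b}" for i j
  proof -
    have "D i j = (\<Sum>w=1..b. V j w * (\<Sum>u=1..b. C u w * e i u))"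
      unfolding D_def by (rule response_dirichlet_form[OF sym \<open>b \<le> n\<close> resp V, symmetric])
    also have "\<dots> = (\<Sum>w=1..b. e j w * C i w)"
      using V[of j] ij unfolding voltages_def
      by (intro sum.cong) (auto simp: e_def if_distrib if_distribR sum.delta cong: if_cong)
    also have "\<dots> = C i j"
      using ij by (simp add: e_def if_distrib if_distribR sum.delta cong: if_cong)
    finally show ?thesis by simp
  qed
  have "D u v = D v u"
    unfolding D_def by (simp add: mult_ac)
  then show ?thesis
    using C_eq uv by simp
qed

text \<open>A constant voltage carries no current.\<close>

lemma response_column_sum:
  assumes resp: "is_response n b c C" and "v \<in> {1..b}"
  shows "(\<Sum>u=1..b. C u v) = 0"
proof -
  have "voltages n b c (\<lambda>_. 1) (\<lambda>_. 1)"
    by (simp add: voltages_def current_def)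
  then have "incoming_current n c (\<lambda>_. 1) v = (\<Sum>u=1..b. C u v * 1)"
    using resp assms(2) unfolding is_response_def by blast
  then show ?thesis
    by (simp add: incoming_current_def current_def)
qed

text \<open>Take \<open>W\<close> to be the conjugate of \<open>U\<close>: products of differences
  become squared moduli, and on the boundary, where \<open>U\<close> is real, conjugation changes
  nothing.\<close>

lemma Re_response_form:
  fixes R :: "nat \<Rightarrow> real"
  assumes sym: "\<And>k l. c k l = c l k" and "b \<le> n" and resp: "is_response n b c C"
    and V: "voltages n b c (\<lambda>u. of_real (R u)) U"
  shows "(\<Sum>u=1..b. \<Sum>v=1..b. Re (C u v) * R u * R v) =
    (\<Sum>k=1..n. \<Sum>l=1..n. Re (c k l) * (cmod (U k - U l))\<^sup>2) / 2"
proof -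
  have "(\<Sum>u=1..b. \<Sum>v=1..b. Re (C u v) * R u * R v) =
      (\<Sum>v=1..b. \<Sum>u=1..b. Re (C u v) * R u * R v)"
    by (rule sum.swap)
  also have "\<dots> = Re (\<Sum>v=1..b. cnj (U v) * (\<Sum>u=1..b. C u v * of_real (R u)))"
    using V unfolding voltages_def by (simp add: sum_distrib_left mult_ac)
  also have "\<dots> =
      Re ((\<Sum>k=1..n. \<Sum>l=1..n. c k l * (U k - U l) * (cnj (U k) - cnj (U l))) / 2)"
    by (subst response_dirichlet_form[OF sym \<open>b \<le> n\<close> resp V]) simp
  also have "\<dots> = (\<Sum>k=1..n. \<Sum>l=1..n. Re (c k l) * (cmod (U k - U l))\<^sup>2) / 2"
  proof -
    have "Re (c k l * (U k - U l) * (cnj (U k) - cnj (U l))) =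
        Re (c k l) * (cmod (U k - U l))\<^sup>2" for k l
      unfolding mult.assoc complex_cnj_diff[symmetric] complex_norm_square[symmetric] by simp
    then show ?thesis
      by simp
  qed
  finally show ?thesis .
qed

lemma (in electrical_network) Re_response_form_nonneg:
  fixes R :: "nat \<Rightarrow> real"
  assumes pos: "\<And>k l. (k, l) \<in> parcs G \<Longrightarrow> Re (c k l) > 0" and resp: "is_response n b c C"
  shows "(\<Sum>u=1..b. \<Sum>v=1..b. Re (C u v) * R u * R v) \<ge> 0"
proof -
  obtain U where U: "voltages n b c (\<lambda>u. of_real (R u)) U"
    using resp unfolding is_response_def by blast
  have "Re (c k l) \<ge> 0" for k l
    using pos[of k l] conductance_no_edge[of k l] by (cases "(k, l) \<in> parcs G") auto
  then show ?thesis
    unfolding Re_response_form[OF conductance_sym boundary resp U] by (simp add: sum_nonneg)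
qed

text \<open>The Dirichlet form has non-negative terms, so each vanishes; \<open>U\<close> then
  agrees along every edge and is constant by connectedness.\<close>

lemma (in electrical_network) Re_response_form_eq_0_imp_const:
  fixes R :: "nat \<Rightarrow> real"
  assumes conn: "Digraph_Component.connected (with_proj G)"
    and pos: "\<And>k l. (k, l) \<in> parcs G \<Longrightarrow> Re (c k l) > 0" and resp: "is_response n b c C"
    and zero: "(\<Sum>u=1..b. \<Sum>v=1..b. Re (C u v) * R u * R v) = 0"
    and uv: "u \<in> {1..b}" "v \<in> {1..b}"
  shows "R u = R v"
proof -
  obtain U where U: "voltages n b c (\<lambda>u. of_real (R u)) U"
    using resp unfolding is_response_def by blast
  have nonneg: "Re (c k l) \<ge> 0" for k l
    using pos[of k l] conductance_no_edge[of k l] by (cases "(k, l) \<in> parcs G") auto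
  have "(\<Sum>k=1..n. \<Sum>l=1..n. Re (c k l) * (cmod (U k - U l))\<^sup>2) = 0"
    using zero Re_response_form[OF conductance_sym boundary resp U] by simp
  then have term0: "Re (c k l) * (cmod (U k - U l))\<^sup>2 = 0" if "k \<in> {1..n}" "l \<in> {1..n}" for k l
    using that nonneg by (simp add: sum_nonneg_eq_0_iff sum_nonneg)
  have eq_on_arcs: "U k = U l" if "(k, l) \<in> parcs G" for k l
  proof -
    have "k \<in> {1..n}" "l \<in> {1..n}"
      using that vertices in_arcsD1 in_arcsD2 by auto
    then show ?thesis
      using term0[of k l] pos[OF that] by simp
  qed
  have "u \<in> {1..n}" "v \<in> {1..n}"
    using uv boundary by auto
  then have "U u = U v"
    using connected_eq_if_eq_on_arcs[of U, OF conn eq_on_arcs] by blast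
  then show ?thesis
    using U uv unfolding voltages_def by simp
qed

section \<open>Realising a matrix\<close>

definition complete_pair_graph :: "nat \<Rightarrow> nat pair_pre_digraph" where
  "complete_pair_graph n =
    \<lparr>pverts = {1..n}, parcs = {(k, l). k \<in> {1..n} \<and> l \<in> {1..n} \<and> k \<noteq> l}\<rparr>"

lemma pair_graph_complete_pair_graph: "pair_graph (complete_pair_graph n)"
proof
  have "parcs (complete_pair_graph n) \<subseteq> {1..n} \<times> {1..n}"
    by (auto simp: complete_pair_graph_def)
  then show "finite (parcs (complete_pair_graph n))"
    by (rule finite_subset) simp
  show "symmetric (with_proj (complete_pair_graph n))"
    by (auto simp: symmetric_def complete_pair_graph_def intro: symI)
qed (auto simp: complete_pair_graph_def)

lemma connected_complete_pair_graph:
  assumes "n \<ge> 1"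
  shows "Digraph_Component.connected (with_proj (complete_pair_graph n))"
proof -
  interpret pair_graph "complete_pair_graph n"
    by (rule pair_graph_complete_pair_graph)
  have "u \<rightarrow>\<^sup>*\<^bsub>with_proj (complete_pair_graph n)\<^esub> v" if "u \<in> {1..n}" "v \<in> {1..n}" for u v
  proof (cases "u = v")
    case True
    then show ?thesis
      using that reachable_refl[of u] by (simp add: complete_pair_graph_def)
  next
    case False
    then show ?thesis
      using that reachable_adjI[of u v] by (simp add: complete_pair_graph_def)
  qed
  then show ?thesis
    using assms unfolding Digraph_Component.connected_def
    by (intro strongly_connectedI reachable_mk_symmetricI)
      (auto simp: complete_pair_graph_def)
qed

section \<open>Stars with parallel edges\<close>

lemma sum_atLeast1_atMost_Suc: "(\<Sum>k=1..Suc b. f k) = (\<Sum>k=1..b. f k) + f (Suc b)"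
  by simp

text \<open>
  If the vertices \<open>1, \<dots>, b\<close> are joined to one interior vertex by conductances \<open>y\<^sub>i\<close> of sum \<open>s\<close>,
  the response of this star is that of the complete graph with conductances \<open>y\<^sub>i y\<^sub>j / s\<close>; the
  remaining part of \<open>C\<close> is supplied by edges in parallel.
\<close>

lemma star_with_parallel_edges_response:
  fixes y :: "nat \<Rightarrow> complex"
  assumes s: "(\<Sum>i=1..b. y i) = s" "s \<noteq> 0"
    and sym: "\<And>i j. i \<in> {1..b} \<Longrightarrow> j \<in> {1..b} \<Longrightarrow> C i j = C j i"
    and row: "\<And>i. i \<in> {1..b} \<Longrightarrow> (\<Sum>j=1..b. C i j) = 0"
    and hub: "\<And>i. i \<in> {1..b} \<Longrightarrow> c i (Suc b) = y i" "\<And>i. i \<in> {1..b} \<Longrightarrow> c (Suc b) i = y i"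
    and edge: "\<And>i j. i \<in> {1..b} \<Longrightarrow> j \<in> {1..b} \<Longrightarrow> i \<noteq> j \<Longrightarrow> c i j = - C i j - y i * y j / s"
  shows "is_response (Suc b) b c C"
proof -
  \<comment> \<open>The hub is the only interior vertex; since \<open>s\<close> is non-zero,
    Kirchhoff's law there determines its voltage as a weighted mean of the boundary
    voltages.\<close>
  have volt: "voltages (Suc b) b c Uin U \<longleftrightarrow>
      (\<forall>u\<in>{1..b}. U u = Uin u) \<and> U (Suc b) = (\<Sum>i=1..b. y i * Uin i) / s" for Uin U
  proof -
    have "(\<Sum>l=1..Suc b. current c U (Suc b) l) = (\<Sum>l=1..b. y l * (U (Suc b) - U l))"
      unfolding sum_atLeast1_atMost_Suc by (auto simp: current_def hub intro!: sum.cong)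
    also have "\<dots> = s * U (Suc b) - (\<Sum>l=1..b. y l * U l)"
      by (simp add: right_diff_distrib sum_subtractf sum_distrib_right[symmetric] s(1)[simplified])
    finally have hub_sum:
      "(\<Sum>l=1..Suc b. current c U (Suc b) l) = s * U (Suc b) - (\<Sum>l=1..b. y l * U l)" .
    have eq: "{b<..Suc b} = {Suc b}"
      by auto
    have "(\<Sum>l=1..b. y l * U l) = (\<Sum>l=1..b. y l * Uin l)" if "\<forall>u\<in>{1..b}. U u = Uin u"
      using that by (intro sum.cong) auto
    then show ?thesis
      unfolding voltages_def eq ball_simps hub_sum using s(2) by (auto simp: field_simps)
  qed
  have curr: "incoming_current (Suc b) c U v = (\<Sum>u=1..b. C u v * Uin u)"
    if U: "voltages (Suc b) b c Uin U" and v: "v \<in> {1..b}" for Uin U v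
  proof -
    let ?Y = "\<Sum>i=1..b. y i * Uin i"
    have "incoming_current (Suc b) c U v =
        (\<Sum>k=1..b. c v k * (U v - U k)) + y v * (U v - U (Suc b))"
      unfolding incoming_current_def current_def sum_atLeast1_atMost_Suc using v by (simp add: hub)
    also have "(\<Sum>k=1..b. c v k * (U v - U k)) =
        (\<Sum>k=1..b. (- C v k - y v * y k / s) * (Uin v - Uin k))"
    proof (rule sum.cong)
      \<comment> \<open>For \<open>k = v\<close> nothing is assumed about \<open>c v v\<close>, but
        the voltage difference vanishes.\<close>
      fix k assume k: "k \<in> {1..b}"
      then show "c v k * (U v - U k) = (- C v k - y v * y k / s) * (Uin v - Uin k)"
        using U v edge[OF v k] unfolding volt by (cases "k = v") auto
    qed simp
    also have "\<dots> = (\<Sum>k=1..b. C v k * Uin k - C v k * Uin v + y v / s * (y k * Uin k)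
        - y k * (y v * Uin v / s))"
      using s(2) by (intro sum.cong) (simp_all add: field_simps)
    also have "\<dots> = (\<Sum>k=1..b. C v k * Uin k) - (\<Sum>k=1..b. C v k) * Uin v + y v / s * ?Y
        - (\<Sum>k=1..b. y k) * (y v * Uin v / s)"
      unfolding sum.distrib sum_subtractf sum_distrib_left sum_distrib_right ..
    also have "\<dots> = (\<Sum>k=1..b. C v k * Uin k) + y v / s * ?Y - y v * Uin v"
      using s row[OF v] by simp
    also have "\<dots> + y v * (U v - U (Suc b)) = (\<Sum>k=1..b. C v k * Uin k)"
      using U v unfolding volt by (simp add: algebra_simps)
    also have "\<dots> = (\<Sum>u=1..b. C u v * Uin u)"
      using sym v by (intro sum.cong) auto
    finally show ?thesis .
  qed
  have "voltages (Suc b) b c Uin (Uin(Suc b := (\<Sum>i=1..b. y i * Uin i) / s))" for Uin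
    unfolding volt by auto
  then show ?thesis
    unfolding is_response_def using curr by blast
qed

text \<open>
  The hub conductances \<open>y\<^sub>i = d + \<i> \<surd>(bd) t\<^sub>i\<close> have real sum \<open>bd\<close>, so
  \<open>Re (y\<^sub>i y\<^sub>j / (bd)) = d / b - t\<^sub>i t\<^sub>j\<close>: an arbitrary rank one correction up to a small error.
\<close>

lemma realise_response_if_rank_one_correction:
  fixes t :: "nat \<Rightarrow> real"
  assumes "b \<ge> 1"
    and sym: "\<And>i j. i \<in> {1..b} \<Longrightarrow> j \<in> {1..b} \<Longrightarrow> C i j = C j i"
    and row: "\<And>i. i \<in> {1..b} \<Longrightarrow> (\<Sum>j=1..b. C i j) = 0"
    and t: "(\<Sum>i=1..b. t i) = 0"
    and gt: "\<And>i j. i \<in> {1..b} \<Longrightarrow> j \<in> {1..b} \<Longrightarrow> i \<noteq> j \<Longrightarrow> Re (C i j) < t i * t j"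
  shows "\<exists>n G c. electrical_network n b G c \<and> Digraph_Component.connected (with_proj G) \<and>
    (\<forall>(k, l)\<in>parcs G. Re (c k l) > 0) \<and> is_response n b c C"
proof -
  define P where "P = {(i, j). i \<in> {1..b} \<and> j \<in> {1..b} \<and> i \<noteq> j}"
  \<comment> \<open>The inserted \<open>1\<close> covers an empty \<open>P\<close>
    (\<open>b = 1\<close>); halving the gaps makes \<open>d\<close> strictly smaller than
    each.\<close>
  define d where "d = Min (insert 1 ((\<lambda>(i, j). (t i * t j - Re (C i j)) / 2) ` P))"
  have "finite P"
    by (rule finite_subset[of _ "{1..b} \<times> {1..b}"]) (auto simp: P_def)
  then have d: "d > 0"
    unfolding d_def using gt by (subst Min_gr_iff) (auto simp: P_def)
  have d_less: "d < t i * t j - Re (C i j)" if "(i, j) \<in> P" for i j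
  proof -
    have "d \<le> (t i * t j - Re (C i j)) / 2"
      unfolding d_def using \<open>finite P\<close> that by (intro Min_le) auto
    then show ?thesis
      using d by simp
  qed
  define s where "s = real b * d"
  have s: "s > 0"
    using d \<open>b \<ge> 1\<close> by (simp add: s_def)
  define y where "y i = Complex d (sqrt s * t i)" for i
  have y_sum: "(\<Sum>i=1..b. y i) = of_real s"
    using t by (simp add: y_def s_def complex_eq_iff sum_distrib_left[symmetric])
  have Re_y: "Re (y i * y j / of_real s) = d / real b - t i * t j" for i j
  proof -
    have "Re (y i * y j / of_real s) = (d * d - (sqrt s * sqrt s) * (t i * t j)) / s"
      by (simp add: y_def mult_ac)
    also have "\<dots> = d * d / s - t i * t j"
      using s by (simp add: diff_divide_distrib)
    also have "d * d / s = d / real b"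
      using d by (simp add: s_def)
    finally show ?thesis .
  qed
  define c where "c k l =
    (if (k, l) \<in> P then - C k l - y k * y l / of_real s
     else if k \<in> {1..b} \<and> l = Suc b then y k
     else if k = Suc b \<and> l \<in> {1..b} then y l else 0)" for k l
  have c_sym: "c k l = c l k" for k l
    using sym by (auto simp: c_def P_def)
  have arcs: "parcs (complete_pair_graph (Suc b)) = P \<union> {1..b} \<times> {Suc b} \<union> {Suc b} \<times> {1..b}"
    by (auto simp: complete_pair_graph_def P_def)
  have "electrical_network (Suc b) b (complete_pair_graph (Suc b)) c"
    using c_sym unfolding electrical_network_def electrical_network_axioms_def arcs
    by (auto simp: pair_graph_complete_pair_graph) (auto simp: complete_pair_graph_def c_def)
  moreover have "Digraph_Component.connected (with_proj (complete_pair_graph (Suc b)))"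
    by (rule connected_complete_pair_graph) simp
  moreover have "Re (c k l) > 0" if "(k, l) \<in> parcs (complete_pair_graph (Suc b))" for k l
  proof (cases "(k, l) \<in> P")
    case True
    have "d / real b \<le> d"
      using d \<open>b \<ge> 1\<close> by (simp add: field_simps)
    moreover have "Re (c k l) = - Re (C k l) - Re (y k * y l / of_real s)"
      using True by (simp add: c_def)
    ultimately show ?thesis
      using d_less[OF True] unfolding Re_y by linarith
  next
    case False
    then show ?thesis
      using that d unfolding arcs by (auto simp: c_def y_def)
  qed
  moreover have "is_response (Suc b) b c C"
    by (rule star_with_parallel_edges_response[OF y_sum _ sym row])
      (use s in \<open>auto simp: c_def P_def\<close>)
  ultimately show ?thesis
    by blast
qed

section \<open>Rank one corrections for three real numbers\<close>

text \<open>With \<open>x = - y - z\<close> and \<open>y\<close>, \<open>z\<close> equal to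
  \<open>sqrt k\<close> times the square roots of \<open>p + r\<close> and \<open>p + q\<close>, all
  three inequalities become linear in \<open>k\<close>; \<open>det\<close> makes the interval of
  admissible \<open>k\<close> non-empty.\<close>

lemma rank_one_correction_nonpos:
  fixes p q r :: real
  assumes "p \<le> 0" and pq: "p + q > 0" and pr: "p + r > 0" and det: "p*q + q*r + r*p > 0"
  shows "\<exists>x y z. x + y + z = 0 \<and> p + y*z > 0 \<and> q + x*z > 0 \<and> r + x*y > 0"
proof -
  define m where "m = sqrt (p + r) * sqrt (p + q)"
  have m: "m > 0"
    using pq pr by (simp add: m_def)
  have "(- p)\<^sup>2 < (p + r) * (p + q)"
    using det by (simp add: power2_eq_square algebra_simps)
  also have "\<dots> = m\<^sup>2"
    using pq pr by (simp add: m_def power_mult_distrib)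
  finally have "- p < m"
    using m by (simp add: power2_less_imp_less)
  \<comment> \<open>With denominators cleared this reads
    \<open>(p + m) * (p + a) > 0\<close>.\<close>
  have bound: "- p / m < a / (a + p + m)" if "p + a > 0" for a
  proof -
    have "- p * (p + a) < m * (p + a)"
      using \<open>- p < m\<close> that by (intro mult_strict_right_mono)
    then show ?thesis
      using m that by (simp add: field_simps)
  qed
  then have "- p / m < min (q / (q + p + m)) (r / (r + p + m))"
    using pq pr by simp
  then obtain k where k: "- p / m < k" "k < q / (q + p + m)" "k < r / (r + p + m)"
    using dense by (metis min_less_iff_conj)
  have "0 \<le> - p / m"
    using \<open>p \<le> 0\<close> m by (simp add: divide_nonpos_pos)
  then have "k > 0"
    using k by linarith
  \<comment> \<open>For \<open>k = - p / m\<close> this choice makes \<open>p + y z\<close> vanish and the other two quantities positive.\<close>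
  define y z where "y = sqrt k * sqrt (p + r)" and "z = sqrt k * sqrt (p + q)"
  have yz: "y * z = k * m" "y * y = k * (p + r)" "z * z = k * (p + q)"
    using \<open>k > 0\<close> pq pr
    by (simp_all add: y_def z_def m_def power2_eq_square[symmetric] power_mult_distrib)
  have "p + y * z > 0"
    using k m by (simp add: yz field_simps)
  moreover have "q + (- y - z) * z > 0"
  proof -
    have "k * (q + p + m) < q"
      using k pq m by (simp add: less_divide_eq)
    then show ?thesis
      using yz by (simp add: algebra_simps)
  qed
  moreover have "r + (- y - z) * y > 0"
  proof -
    have "k * (r + p + m) < r"
      using k pr m by (simp add: less_divide_eq)
    then show ?thesis
      using yz by (simp add: algebra_simps)
  qed
  ultimately show ?thesis
    by (intro exI[of _ "- y - z"] exI[of _ y] exI[of _ z]) simp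
qed

text \<open>If all three numbers are positive, zero works. Otherwise a simultaneous permutation of
  \<open>p, q, r\<close> and \<open>x, y, z\<close>, which preserves the problem, moves a
  non-positive number to the front.\<close>

lemma rank_one_correction:
  fixes p q r :: real
  assumes "p + q > 0" "p + r > 0" "q + r > 0" and det: "p*q + q*r + r*p > 0"
  shows "\<exists>x y z. x + y + z = 0 \<and> p + y*z > 0 \<and> q + x*z > 0 \<and> r + x*y > 0"
proof -
  consider "p > 0" "q > 0" "r > 0" | "p \<le> 0" | "q \<le> 0" | "r \<le> 0"
    by linarith
  then show ?thesis
  proof cases
    case 1
    then show ?thesis
      by (intro exI[of _ 0]) simp
  next
    case 2
    then show ?thesis
      using rank_one_correction_nonpos assms by blast
  next
    case 3
    then obtain x y z where "x + y + z = 0" "q + y*z > 0" "p + x*z > 0" "r + x*y > 0"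
      using rank_one_correction_nonpos[of q p r] assms by (auto simp: ac_simps)
    then show ?thesis
      by (intro exI[of _ y] exI[of _ x] exI[of _ z]) (simp add: ac_simps)
  next
    case 4
    then obtain x y z where "x + y + z = 0" "r + y*z > 0" "q + x*z > 0" "p + x*y > 0"
      using rank_one_correction_nonpos[of r q p] assms by (auto simp: ac_simps)
    then show ?thesis
      by (intro exI[of _ z] exI[of _ y] exI[of _ x]) (simp add: ac_simps)
  qed
qed

section \<open>Two and three boundary vertices\<close>

lemma atLeastAtMost_1_2: "{1..2::nat} = {1, 2}"
  and atLeastAtMost_1_3: "{1..3::nat} = {1, 2, 3}"
  by auto

lemma realise_response_2:
  assumes sym: "\<And>u v. u \<in> {1..2} \<Longrightarrow> v \<in> {1..2} \<Longrightarrow> C u v = C v u"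
    and row: "\<And>u. u \<in> {1..2} \<Longrightarrow> (\<Sum>v=1..2. C u v) = 0"
    and nonneg: "\<And>U :: nat \<Rightarrow> real. (\<Sum>u=1..2. \<Sum>v=1..2. Re (C u v) * U u * U v) \<ge> 0"
    and pos_def: "\<And>U :: nat \<Rightarrow> real. (\<Sum>u=1..2. \<Sum>v=1..2. Re (C u v) * U u * U v) = 0 \<Longrightarrow>
      \<forall>u\<in>{1..2}. \<forall>v\<in>{1..2}. U u = U v"
  shows "\<exists>n G c. electrical_network n 2 G c \<and> Digraph_Component.connected (with_proj G) \<and>
    (\<forall>(k, l)\<in>parcs G. Re (c k l) > 0) \<and> is_response n 2 c C"
proof -
  let ?U = "\<lambda>u::nat. if u = 1 then 1 else 0 :: real"
  have form: "(\<Sum>u=1..2. \<Sum>v=1..2. Re (C u v) * ?U u * ?U v) = Re (C 1 1)"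
    by (simp add: atLeastAtMost_1_2 del: One_nat_def)
  have "\<not> (\<forall>u\<in>{1..2}. \<forall>v\<in>{1..2}. ?U u = ?U v)"
    by (simp add: atLeastAtMost_1_2 del: One_nat_def)
  then have "Re (C 1 1) \<noteq> 0"
    using pos_def[of ?U] unfolding form by blast
  then have "Re (C 1 1) > 0"
    using nonneg[of ?U] unfolding form by linarith
  moreover have "C 1 1 + C 1 2 = 0"
    using row[of 1] by (simp add: atLeastAtMost_1_2 del: One_nat_def)
  then have "Re (C 1 1) + Re (C 1 2) = 0"
    by (metis plus_complex.simps(1) zero_complex.simps(1))
  moreover have "C 2 1 = C 1 2"
    by (rule sym) auto
  ultimately have "Re (C 1 2) < 0" "Re (C 2 1) < 0"
    by simp_all
  then show ?thesis
    by (intro realise_response_if_rank_one_correction[where t = "\<lambda>_. 0", OF _ sym row])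
      (auto simp: atLeastAtMost_1_2 simp del: One_nat_def)
qed

lemma realise_response_3:
  assumes sym: "\<And>u v. u \<in> {1..3} \<Longrightarrow> v \<in> {1..3} \<Longrightarrow> C u v = C v u"
    and row: "\<And>u. u \<in> {1..3} \<Longrightarrow> (\<Sum>v=1..3. C u v) = 0"
    and nonneg: "\<And>U :: nat \<Rightarrow> real. (\<Sum>u=1..3. \<Sum>v=1..3. Re (C u v) * U u * U v) \<ge> 0"
    and pos_def: "\<And>U :: nat \<Rightarrow> real. (\<Sum>u=1..3. \<Sum>v=1..3. Re (C u v) * U u * U v) = 0 \<Longrightarrow>
      \<forall>u\<in>{1..3}. \<forall>v\<in>{1..3}. U u = U v"
  shows "\<exists>n G c. electrical_network n 3 G c \<and> Digraph_Component.connected (with_proj G) \<and>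
    (\<forall>(k, l)\<in>parcs G. Re (c k l) > 0) \<and> is_response n 3 c C"
proof -
  \<comment> \<open>Each of \<open>p\<close>, \<open>q\<close>, \<open>r\<close> belongs to the edge
    opposite vertex 1, 2, 3, matching the products \<open>y*z\<close>, \<open>x*z\<close>,
    \<open>x*y\<close>.\<close>
  define p q r where "p = - Re (C 2 3)" and "q = - Re (C 1 3)" and "r = - Re (C 1 2)"
  have C_sym: "C 2 1 = C 1 2" "C 3 1 = C 1 3" "C 3 2 = C 2 3"
    by (rule sym; simp)+
  have "C 1 1 + C 1 2 + C 1 3 = 0" "C 1 2 + C 2 2 + C 2 3 = 0" "C 1 3 + C 2 3 + C 3 3 = 0"
    using row[of 1] row[of 2] row[of 3]
    by (simp_all add: atLeastAtMost_1_3 C_sym add.assoc del: One_nat_def)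
  then have diag:
    "C 1 1 = - C 1 2 - C 1 3" "C 2 2 = - C 1 2 - C 2 3" "C 3 3 = - C 1 3 - C 2 3"
    by algebra+
  have form: "(\<Sum>u=1..3. \<Sum>v=1..3. Re (C u v) * U u * U v) =
      p * (U 2 - U 3)\<^sup>2 + q * (U 1 - U 3)\<^sup>2 + r * (U 1 - U 2)\<^sup>2" for U :: "nat \<Rightarrow> real"
    unfolding atLeastAtMost_1_3
    by (simp add: diag C_sym p_def q_def r_def power2_eq_square algebra_simps del: One_nat_def)
  have gt: "p * (y - z)\<^sup>2 + q * (x - z)\<^sup>2 + r * (x - y)\<^sup>2 > 0"
    if "x \<noteq> y \<or> y \<noteq> z" for x y z :: real
  proof -
    let ?U = "\<lambda>u::nat. if u = 1 then x else if u = 2 then y else z"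
    have "\<not> (\<forall>u\<in>{1..3}. \<forall>v\<in>{1..3}. ?U u = ?U v)"
      unfolding atLeastAtMost_1_3 using that by (auto simp del: One_nat_def)
    then have "(\<Sum>u=1..3. \<Sum>v=1..3. Re (C u v) * ?U u * ?U v) \<noteq> 0"
      using pos_def[of ?U] by blast
    then have "(\<Sum>u=1..3. \<Sum>v=1..3. Re (C u v) * ?U u * ?U v) > 0"
      using nonneg[of ?U] by linarith
    then show ?thesis
      unfolding form by simp
  qed
  have sums: "p + q > 0" "p + r > 0" "q + r > 0"
    using gt[of 0 0 1] gt[of 0 1 0] gt[of 1 0 0] by simp_all
  \<comment> \<open>The voltages \<open>r, q + r, 0\<close> are harmonic at vertex 1, so they
    minimise the form for the given values at vertices 2 and 3.\<close>
  have "(q + r) * (p*q + q*r + r*p) > 0"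
    using gt[of r "q + r" 0] sums by (simp add: power2_eq_square algebra_simps)
  then have "p*q + q*r + r*p > 0"
    using sums by (simp add: zero_less_mult_iff)
  then obtain x y z where xyz: "x + y + z = 0" "p + y*z > 0" "q + x*z > 0" "r + x*y > 0"
    using rank_one_correction[OF sums] by blast
  show ?thesis
    by (rule realise_response_if_rank_one_correction
        [where t = "\<lambda>u. if u = 1 then x else if u = 2 then y else z", OF _ sym row])
      (use xyz C_sym in \<open>auto simp: atLeastAtMost_1_3 p_def q_def r_def ac_simps
        simp del: One_nat_def\<close>)
qed

theorem theorem11:
  fixes b :: nat and C :: "nat \<Rightarrow> nat \<Rightarrow> complex"
  assumes "b \<in> {2, 3}"
  shows "(\<exists>n G c. electrical_network n b G c \<and>
            Digraph_Component.connected (with_proj G) \<and>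
            (\<forall>(k, l)\<in>parcs G. Re (c k l) > 0) \<and>
            is_response n b c C)
     \<longleftrightarrow>
         ((\<forall>u\<in>{1..b}. \<forall>v\<in>{1..b}. C u v = C v u) \<and>
          (\<forall>u\<in>{1..b}. (\<Sum>v=1..b. C u v) = 0) \<and>
          (\<forall>U :: nat \<Rightarrow> real. (\<Sum>u=1..b. \<Sum>v=1..b. Re (C u v) * U u * U v) \<ge> 0) \<and>
          (\<forall>U :: nat \<Rightarrow> real. (\<Sum>u=1..b. \<Sum>v=1..b. Re (C u v) * U u * U v) = 0 \<longrightarrow>
             (\<forall>u\<in>{1..b}. \<forall>v\<in>{1..b}. U u = U v)))"
  (is "?realisable \<longleftrightarrow> ?sym \<and> ?row \<and> ?nonneg \<and> ?pos_def")
proof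
  assume ?realisable
  then obtain n G c where net: "electrical_network n b G c"
    and conn: "Digraph_Component.connected (with_proj G)"
    and pos: "\<And>k l. (k, l) \<in> parcs G \<Longrightarrow> Re (c k l) > 0" and resp: "is_response n b c C"
    by blast
  interpret electrical_network n b G c
    by (rule net)
  have sym: ?sym
    using response_symmetric[OF conductance_sym boundary resp] by blast
  \<comment> \<open>Constant voltages give column sums; symmetry turns them into row sums.\<close>
  have row: ?row
  proof
    fix u assume u: "u \<in> {1..b}"
    have "(\<Sum>v=1..b. C u v) = (\<Sum>v=1..b. C v u)"
      using sym u by (intro sum.cong) auto
    then show "(\<Sum>v=1..b. C u v) = 0"
      using response_column_sum[OF resp u] by simp
  qed
  show "?sym \<and> ?row \<and> ?nonneg \<and> ?pos_def"
    using sym row Re_response_form_nonneg[OF pos resp]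
      Re_response_form_eq_0_imp_const[OF conn pos resp] by blast
next
  assume R: "?sym \<and> ?row \<and> ?nonneg \<and> ?pos_def"
  from assms consider "b = 2" | "b = 3"
    by auto
  then show ?realisable
  proof cases
    case 1
    show ?thesis
      unfolding 1 by (rule realise_response_2) (use R[unfolded 1] in blast)+
  next
    case 2
    show ?thesis
      unfolding 2 by (rule realise_response_3) (use R[unfolded 2] in blast)+
  qed
qed

end
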